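(* Let $\Phi=(G,\varphi)$ be a $\mathbb{T}$-gain graph on a connected graph $G$ with $n$ vertices. Let $T$ be a normal spanning tree of $G$, and let $\{C_1,\dots,C_l\}$ be the collection of all fundamental cycles of $G$ with respect to $T$. Then $$\mathcal{E}(\Phi)\geq 2\sum_{j=1}^{l}\Re\big(\varphi(C_j)\big)+(5n-n^2-4),$$ and this inequality is sharp.
   Context: A $\mathbb{T}$-gain graph $\Phi=(G,\varphi)$ consists of a finite simple graph $G$ and a map $\varphi$ assigning to each orientation $\overrightarrow{e_{p,q}}$ of each edge $v_pv_q$ a value in $\mathbb{T}=\{z\in\mathbb{C}:|z|=1\}$, with $\varphi(\overrightarrow{e_{q,p}})=\varphi(\overrightarrow{e_{p,q}})^{-1}$. Its adjacency matrix $A(\Phi)$ is the Hermitian matrix whose $(p,q)$ entry is $\varphi(\overrightarrow{e_{p,q}})$ if $v_p\sim v_q$ and $0$ otherwise; the energy $\mathcal{E}(\Phi)$ is the sum of absolute values of its eigenvalues. A normal spanning tree is a rooted spanning tree $T$ such that the two ends of every edge of $G$ are comparable in the tree order (one is an ancestor of the other in $T$). For a spanning tree $T$, each edge $e\notin E(T)$ creates a unique cycle in $T+e$, called a fundamental cycle. The gain of an oriented cycle $\overrightarrow{C}$ is the product of the gains of its oriented edges; the two orientations have mutually inverse gains, hence the same real part, denoted $\Re(\varphi(C))$. *)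

theory Defs
  imports
    "Graph_Theory.Digraph_Component"
    "Graph_Theory.Pair_Digraph"
    "Jordan_Normal_Form.Char_Poly"
begin

text \<open>
  A finite simple graph is a finite, symmetric, loop-free pair digraph (\<^locale>\<open>pair_graph\<close>): the
  arcs \<open>(u, v)\<close> and \<open>(v, u)\<close> are the two orientations of the edge \<open>uv\<close>.
\<close>

locale gain_graph = pair_graph G for G :: "'a pair_pre_digraph" +
  fixes \<phi> :: "'a \<times> 'a \<Rightarrow> complex"
  assumes gain_unit: "(u, v) \<in> parcs G \<Longrightarrow> cmod (\<phi> (u, v)) = 1"
    and gain_reverse: "(u, v) \<in> parcs G \<Longrightarrow> \<phi> (v, u) = inverse (\<phi> (u, v))"

text \<open>The list \<open>vs\<close> enumerates the vertices of \<open>G\<close> and fixes the order of rows and columns.\<close>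

definition adjacency :: "'a pair_pre_digraph \<Rightarrow> ('a \<times> 'a \<Rightarrow> complex) \<Rightarrow> 'a list \<Rightarrow> complex mat" where
  "adjacency G \<phi> vs = mat (length vs) (length vs)
     (\<lambda>(p, q). if (vs ! p, vs ! q) \<in> parcs G then \<phi> (vs ! p, vs ! q) else 0)"

text \<open>The roots of the characteristic polynomial are the eigenvalues with their multiplicities.\<close>

definition energy :: "'a pair_pre_digraph \<Rightarrow> ('a \<times> 'a \<Rightarrow> complex) \<Rightarrow> 'a list \<Rightarrow> real" where
  "energy G \<phi> vs = (\<Sum>z\<in>#proots (char_poly (adjacency G \<phi> vs)). cmod z)"

text \<open>
  In a symmetric digraph \<^const>\<open>pre_digraph.cycle\<close> also holds for the closed walks \<open>u, v, u\<close>, which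
  are not cycles of the undirected graph; hence the bound on the length. For the same reason
  \<^const>\<open>Digraph_Component.spanning_tree\<close> is not the undirected notion and is not used below.
\<close>

definition oriented_cycle :: "'a pair_pre_digraph \<Rightarrow> ('a \<times> 'a) list \<Rightarrow> bool" where
  "oriented_cycle G p \<longleftrightarrow> pre_digraph.cycle (with_proj G) p \<and> 3 \<le> length p"

definition undirected_tree :: "'a pair_pre_digraph \<Rightarrow> bool" where
  "undirected_tree T \<longleftrightarrow>
     pair_graph T \<and> Digraph_Component.connected (with_proj T) \<and> (\<nexists>p. oriented_cycle T p)"

definition undirected_spanning_tree :: "'a pair_pre_digraph \<Rightarrow> 'a pair_pre_digraph \<Rightarrow> bool" where
  "undirected_spanning_tree T G \<longleftrightarrow> undirected_tree T \<and> spanning (with_proj T) (with_proj G)"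

definition ancestor :: "'a pair_pre_digraph \<Rightarrow> 'a \<Rightarrow> 'a \<Rightarrow> 'a \<Rightarrow> bool" where
  "ancestor T r u v \<longleftrightarrow>
     (\<exists>p. pre_digraph.apath (with_proj T) r p v \<and> u \<in> set (pre_digraph.awalk_verts (with_proj T) r p))"

definition normal_spanning_tree :: "'a pair_pre_digraph \<Rightarrow> 'a \<Rightarrow> 'a pair_pre_digraph \<Rightarrow> bool" where
  "normal_spanning_tree T r G \<longleftrightarrow>
     undirected_spanning_tree T G \<and> r \<in> pverts T \<and>
     (\<forall>(u, v) \<in> parcs G. ancestor T r u v \<or> ancestor T r v u)"

definition add_edge :: "'a pair_pre_digraph \<Rightarrow> 'a \<times> 'a \<Rightarrow> 'a pair_pre_digraph" where
  "add_edge T e = \<lparr>pverts = pverts T, parcs = parcs T \<union> {e, prod.swap e}\<rparr>"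

text \<open>
  An undirected cycle is represented by its set of edges, forgetting orientation and starting
  vertex.
\<close>

definition edge_set :: "('a \<times> 'a) list \<Rightarrow> 'a set set" where
  "edge_set p = (\<lambda>(u, v). {u, v}) ` set p"

definition fundamental_cycles :: "'a pair_pre_digraph \<Rightarrow> 'a pair_pre_digraph \<Rightarrow> 'a set set set" where
  "fundamental_cycles G T =
     {edge_set p | e p. e \<in> parcs G - parcs T \<and> oriented_cycle (add_edge T e) p}"

definition walk_gain :: "('a \<times> 'a \<Rightarrow> complex) \<Rightarrow> ('a \<times> 'a) list \<Rightarrow> complex" where
  "walk_gain \<phi> p = prod_list (map \<phi> p)"

text \<open>
  The value is unique: two oriented cycles with the same edges differ by a rotation and possibly
  a reversal, so their gains are equal or inverse to each other.
\<close>

definition re_gain :: "'a pair_pre_digraph \<Rightarrow> ('a \<times> 'a \<Rightarrow> complex) \<Rightarrow> 'a set set \<Rightarrow> real" where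
  "re_gain G \<phi> C =
     (THE x. \<exists>p. oriented_cycle G p \<and> edge_set p = C \<and> x = Re (walk_gain \<phi> p))"

end

theory Submission
  imports Defs "Jordan_Normal_Form.Spectral_Radius" "HOL-Analysis.L2_Norm"
begin

text \<open>
  Rescale the gains by the potential \<open>v \<mapsto>\<close> gain of the tree path from the root to \<open>v\<close>.  This turns
  all tree arcs into gain 1 and each other arc into the gain of its fundamental cycle, so the entries
  of the rescaled adjacency matrix sum to \<open>\<sigma> = 2 (n - 1) + 2 \<Sigma> Re \<phi>(C\<^sub>j)\<close>.  The quadratic form at the
  all-ones vector yields an eigenvalue of modulus at least \<open>\<sigma> / n\<close>; as the trace vanishes, the energy
  is at least twice that modulus.  Finally \<open>2 \<sigma> / n \<ge> \<sigma> - (n - 1) (n - 2)\<close> because \<open>\<sigma> \<le> n (n - 1)\<close>.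
  Equality holds for the complete graph with trivial
  gains, whose normal spanning trees are the Hamiltonian paths.
\<close>

section \<open>Eigenvalues of Hermitian matrices\<close>

text \<open>The bound on the spectral radius avoids diagonalising the matrix: divided by any number
  above its spectral radius, it has bounded powers, and this is incompatible with a quadratic form
  larger than the squared norm of the vector. The rescaled matrix is never formed either; its
  all-ones vector corresponds to the vector of conjugate potentials for the original matrix. The
  delicate point of the count is that \<sigma> sums over arcs while fundamental cycles are
  unoriented edge sets. Each cycle has to come from exactly two arcs, and its real gain, a definite
  description over all cycles of \<open>G\<close> with these edges, has to be independent of the
  representative. The constant is 2 (n - 1) - (n - 1) (n - 2) = 5 n - n^2 - 4: the contribution of
  the tree arcs less the loss in the last estimate.\<close>

lemma cscalar_prod_self: "v \<bullet>c v = complex_of_real (\<Sum>i = 0..<dim_vec v. (cmod (v $ i))\<^sup>2)"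
  by (simp add: scalar_prod_def complex_norm_square del: of_real_power)

lemma cscalar_prod_cauchy_schwarz:
  assumes "v \<in> carrier_vec n" "w \<in> carrier_vec n"
  shows "(cmod (v \<bullet>c w))\<^sup>2 \<le> Re (v \<bullet>c v) * Re (w \<bullet>c w)"
proof -
  have "cmod (v \<bullet>c w) \<le> (\<Sum>i = 0..<n. \<bar>cmod (v $ i)\<bar> * \<bar>cmod (w $ i)\<bar>)"
    using assms by (auto simp: scalar_prod_def norm_mult intro!: order.trans[OF norm_sum] sum_mono)
  also have "\<dots> \<le> L2_set (\<lambda>i. cmod (v $ i)) {0..<n} * L2_set (\<lambda>i. cmod (w $ i)) {0..<n}"
    by (rule L2_set_mult_ineq)
  finally have "(cmod (v \<bullet>c w))\<^sup>2 \<le>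
      (L2_set (\<lambda>i. cmod (v $ i)) {0..<n} * L2_set (\<lambda>i. cmod (w $ i)) {0..<n})\<^sup>2"
    by (intro power_mono) auto
  then show ?thesis
    using assms by (simp add: cscalar_prod_self L2_set_def power_mult_distrib sum_nonneg)
qed

lemma cscalar_prod_hermitian:
  assumes A: "A \<in> carrier_mat n n" and v: "v \<in> carrier_vec n" and w: "w \<in> carrier_vec n"
    and herm: "\<And>i j. i < n \<Longrightarrow> j < n \<Longrightarrow> A $$ (j, i) = cnj (A $$ (i, j))"
  shows "(A *\<^sub>v v) \<bullet>c w = v \<bullet>c (A *\<^sub>v w)"
proof -
  have "(A *\<^sub>v v) \<bullet>c w = (\<Sum>i = 0..<n. \<Sum>j = 0..<n. A $$ (i, j) * v $ j * cnj (w $ i))"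
    using assms(1-3) by (simp add: scalar_prod_def sum_distrib_right)
  also have "\<dots> = (\<Sum>j = 0..<n. \<Sum>i = 0..<n. A $$ (i, j) * v $ j * cnj (w $ i))"
    by (rule sum.swap)
  also have "\<dots> = (\<Sum>j = 0..<n. \<Sum>i = 0..<n. v $ j * (cnj (A $$ (j, i)) * cnj (w $ i)))"
  proof (intro sum.cong refl)
    fix i j assume "j \<in> {0..<n}" "i \<in> {0..<n}"
    then show "A $$ (i, j) * v $ j * cnj (w $ i) = v $ j * (cnj (A $$ (j, i)) * cnj (w $ i))"
      by (subst herm[of j i]) auto
  qed
  also have "\<dots> = v \<bullet>c (A *\<^sub>v w)"
    using assms(1-3) by (simp add: scalar_prod_def sum_distrib_left)
  finally show ?thesis .
qed

lemma funpow_mult_mat_vec_carrier: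
  assumes "A \<in> carrier_mat n n" "v \<in> carrier_vec n"
  shows "((*\<^sub>v) A ^^ k) v \<in> carrier_vec n"
  using assms by (induction k) auto

lemma pow_mat_mult_vec:
  assumes A: "A \<in> carrier_mat n n" and v: "v \<in> carrier_vec n"
  shows "A ^\<^sub>m k *\<^sub>v v = ((*\<^sub>v) A ^^ k) v"
  using v
proof (induction k arbitrary: v)
  case (Suc k)
  have "A ^\<^sub>m Suc k *\<^sub>v v = A ^\<^sub>m k *\<^sub>v (A *\<^sub>v v)"
    using assoc_mult_mat_vec[OF _ A Suc.prems, of "A ^\<^sub>m k" n] A by simp
  then show ?case
    using Suc A by (simp add: funpow_swap1)
qed (use A in simp)

lemma cscalar_prod_funpow_hermitian:
  assumes A: "A \<in> carrier_mat n n" and v: "v \<in> carrier_vec n" and w: "w \<in> carrier_vec n"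
    and herm: "\<And>i j. i < n \<Longrightarrow> j < n \<Longrightarrow> A $$ (j, i) = cnj (A $$ (i, j))"
  shows "((*\<^sub>v) A ^^ k) v \<bullet>c w = v \<bullet>c ((*\<^sub>v) A ^^ k) w"
  using w
proof (induction k arbitrary: w)
  case (Suc k)
  have "((*\<^sub>v) A ^^ Suc k) v \<bullet>c w = ((*\<^sub>v) A ^^ k) v \<bullet>c (A *\<^sub>v w)"
    using cscalar_prod_hermitian[OF A funpow_mult_mat_vec_carrier[OF A v] Suc.prems herm] by simp
  also have "\<dots> = v \<bullet>c ((*\<^sub>v) A ^^ k) (A *\<^sub>v w)"
    using A Suc.prems by (intro Suc.IH) simp
  finally show ?case
    by (simp add: funpow_swap1)
qed simp

text \<open>Cauchy--Schwarz squares the normalised quadratic form when \<open>A\<close> is squared.  Hence, if it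
  exceeds 1 for \<open>A\<close>, it is unbounded on the powers of \<open>A\<close>.\<close>

lemma hermitian_bounded_powers_quadratic_form:
  assumes A: "A \<in> carrier_mat n n" and x: "x \<in> carrier_vec n"
    and herm: "\<And>i j. i < n \<Longrightarrow> j < n \<Longrightarrow> A $$ (j, i) = cnj (A $$ (i, j))"
    and bound: "\<And>k. norm_bound (A ^\<^sub>m k) b"
  shows "cmod ((A *\<^sub>v x) \<bullet>c x) \<le> Re (x \<bullet>c x)"
proof (rule ccontr)
  assume less: "\<not> ?thesis"
  define N where "N = Re (x \<bullet>c x)"
  define q where "q k = cmod (((*\<^sub>v) A ^^ (2 ^ k)) x \<bullet>c x)" for k
  have N0: "N \<ge> 0"
    unfolding N_def cscalar_prod_self by (simp add: sum_nonneg)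
  have q0: "q 0 = cmod ((A *\<^sub>v x) \<bullet>c x)"
    using A by (simp add: q_def)
  have step: "(q k)\<^sup>2 \<le> N * q (Suc k)" for k
  proof -
    let ?y = "((*\<^sub>v) A ^^ (2 ^ k)) x"
    have y: "?y \<in> carrier_vec n"
      using A x by (rule funpow_mult_mat_vec_carrier)
    \<comment> \<open>Moving half of the \<open>2 ^ Suc k\<close> factors to the other side turns
      the form of the squared power into a squared norm, to which Cauchy--Schwarz applies.\<close>
    have "?y \<bullet>c ?y = ((*\<^sub>v) A ^^ (2 ^ Suc k)) x \<bullet>c x"
      using cscalar_prod_funpow_hermitian[OF A y x herm, of "2 ^ k"]
      by (simp add: mult_2 funpow_add)
    then have "Re (?y \<bullet>c ?y) \<le> q (Suc k)"
      unfolding q_def using complex_Re_le_cmod by metis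
    moreover have "(q k)\<^sup>2 \<le> Re (?y \<bullet>c ?y) * N"
      unfolding q_def N_def using y x by (rule cscalar_prod_cauchy_schwarz)
    ultimately show ?thesis
      using N0 by (smt (verit) mult.commute mult_left_mono)
  qed
  \<comment> \<open>If \<open>N = 0\<close>, then \<open>step\<close> at 0 forces
    \<open>q 0 = 0\<close>, against \<open>less\<close>.\<close>
  have Npos: "N > 0"
    using less N0 step[of 0] unfolding N_def[symmetric] q0[symmetric] 
    by (cases "N = 0") auto
  define t where "t = q 0 / N"
  have t: "t > 1"
    using less Npos by (simp add: t_def q0 N_def)
  have pow: "t ^ (2 ^ k) \<le> q k / N" for k
  proof (induction k)
    case (Suc k)
    have "t ^ (2 ^ Suc k) = (t ^ (2 ^ k))\<^sup>2"
      by (simp add: power_mult[symmetric] mult.commute)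
    also have "\<dots> \<le> (q k / N)\<^sup>2"
      using Suc t by (intro power_mono) auto
    also have "\<dots> \<le> q (Suc k) / N"
      using step[of k] Npos by (simp add: field_simps power2_eq_square)
    finally show ?case .
  qed (simp add: t_def)
  \<comment> \<open>An entrywise bound on the form that is the same for all powers of
    \<open>A\<close>.\<close>
  define M where "M = (\<Sum>i = 0..<n. \<Sum>j = 0..<n. b * cmod (x $ j) * cmod (x $ i))"
  have "q k \<le> M" for k
  proof -
    let ?B = "A ^\<^sub>m (2 ^ k)"
    have B: "?B \<in> carrier_mat n n"
      using A by simp
    have "q k = cmod ((?B *\<^sub>v x) \<bullet>c x)"
      using A x by (simp add: q_def pow_mat_mult_vec)
    also have "(?B *\<^sub>v x) \<bullet>c x = (\<Sum>i = 0..<n. \<Sum>j = 0..<n. ?B $$ (i, j) * x $ j * cnj (x $ i))"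
      using x A by (simp add: scalar_prod_def sum_distrib_right)
    also have "cmod \<dots> \<le> (\<Sum>i = 0..<n. \<Sum>j = 0..<n. cmod (?B $$ (i, j) * x $ j * cnj (x $ i)))"
      by (rule order.trans[OF norm_sum sum_mono]) (rule norm_sum)
    also have "\<dots> \<le> M"
      unfolding M_def using bound[of "2 ^ k"] A
      by (intro sum_mono) (auto simp: norm_mult norm_bound_def intro!: mult_right_mono)
    finally show ?thesis .
  qed
  then have le: "t ^ (2 ^ k) \<le> M / N" for k
    using pow[of k] Npos by (meson divide_right_mono less_imp_le order.trans)
  obtain k where "M / N < t ^ k"
    using real_arch_pow[OF t] by blast
  also have "\<dots> \<le> t ^ (2 ^ k)"
    using t by (intro power_increasing less_imp_le[OF less_exp]) auto
  finally show False
    using le[of k] by simp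
qed

lemma smult_mat_mult_vec:
  assumes "A \<in> carrier_mat m n" "v \<in> carrier_vec n"
  shows "(c \<cdot>\<^sub>m A) *\<^sub>v v = c \<cdot>\<^sub>v (A *\<^sub>v v :: 'a :: comm_ring_1 vec)"
  using assms by (intro eq_vecI) (auto simp: scalar_prod_def sum_distrib_left mult.assoc)

lemma eigenvalue_smult:
  fixes c :: complex
  assumes "A \<in> carrier_mat n n" "c \<noteq> 0" "eigenvalue (c \<cdot>\<^sub>m A) e"
  shows "eigenvalue A (e / c)"
proof -
  obtain v where v: "v \<in> carrier_vec n" "v \<noteq> 0\<^sub>v n" "(c \<cdot>\<^sub>m A) *\<^sub>v v = e \<cdot>\<^sub>v v"
    using assms unfolding eigenvalue_def eigenvector_def by auto
  have "c \<cdot>\<^sub>v (A *\<^sub>v v) = e \<cdot>\<^sub>v v"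
    using v(3) smult_mat_mult_vec[OF assms(1) v(1)] by simp
  then have "(1 / c) \<cdot>\<^sub>v (c \<cdot>\<^sub>v (A *\<^sub>v v)) = (1 / c) \<cdot>\<^sub>v (e \<cdot>\<^sub>v v)"
    by simp
  then have "A *\<^sub>v v = (e / c) \<cdot>\<^sub>v v"
    using assms by (simp add: smult_smult_assoc)
  then show ?thesis
    using v assms unfolding eigenvalue_def eigenvector_def by auto
qed

text \<open>Take \<open>e\<close> of maximal modulus. For every \<open>c > cmod e\<close> the matrix
  \<open>A / c\<close> has spectral radius below 1, so its Jordan form gives bounded powers and the
  form of \<open>A / c\<close> is at most the squared norm of \<open>x\<close>. Letting
  \<open>c\<close> decrease to \<open>cmod e\<close> gives the claim. The strict gap matters: at
  spectral radius 1, nontrivial Jordan blocks would first have to be excluded.\<close>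

lemma hermitian_quadratic_form_le_eigenvalue:
  assumes A: "A \<in> carrier_mat n n" and n: "n > 0" and x: "x \<in> carrier_vec n"
    and herm: "\<And>i j. i < n \<Longrightarrow> j < n \<Longrightarrow> A $$ (j, i) = cnj (A $$ (i, j))"
  obtains e where "eigenvalue A e" "cmod ((A *\<^sub>v x) \<bullet>c x) \<le> cmod e * Re (x \<bullet>c x)"
proof -
  obtain e where e: "eigenvalue A e" "cmod e = spectral_radius A"
    using spectral_radius_mem_max(1)[OF A n] by (auto simp: spectrum_def)
  have le: "cmod ((A *\<^sub>v x) \<bullet>c x) \<le> c * Re (x \<bullet>c x)" if c: "c > cmod e" for c
  proof -
    have c0: "c > 0"
      using c by (smt (verit) norm_ge_zero)
    define B where "B = complex_of_real (1 / c) \<cdot>\<^sub>m A"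
    have B: "B \<in> carrier_mat n n"
      using A by (simp add: B_def)
    have "cmod f < 1" if "eigenvalue B f" for f
    proof -
      have "eigenvalue A (f / complex_of_real (1 / c))"
        using eigenvalue_smult[OF A _ that[unfolded B_def]] c0 by simp
      then have "cmod (f / complex_of_real (1 / c)) \<le> cmod e"
        unfolding e(2) by (intro spectral_radius_mem_max(2)[OF A n]) (auto simp: spectrum_def)
      then have "cmod f * c \<le> cmod e"
        using c0 by (simp add: norm_mult)
      then show ?thesis
        using c c0 by (smt (verit) mult_le_cancel_right1)
    qed
    then have "spectral_radius B < 1"
      using spectral_radius_mem_max(1)[OF B n] by (auto simp: spectrum_def)
    moreover have "\<exists>n_as. jordan_nf B n_as"
      using char_poly_factorized[OF B] jordan_nf_exists[OF B] by blast
    ultimately obtain b where "\<And>k. norm_bound (B ^\<^sub>m k) b"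
      using spectral_radius_jnf_norm_bound_less_1[OF B] by blast
    then have "cmod ((B *\<^sub>v x) \<bullet>c x) \<le> Re (x \<bullet>c x)"
    proof (intro hermitian_bounded_powers_quadratic_form[OF B x])
      fix i j assume "i < n" "j < n"
      then show "B $$ (j, i) = cnj (B $$ (i, j))"
        using herm[of i j] A by (simp add: B_def)
    qed
    moreover have "(B *\<^sub>v x) \<bullet>c x = complex_of_real (1 / c) * ((A *\<^sub>v x) \<bullet>c x)"
      using A x by (simp add: B_def smult_mat_mult_vec[OF A x])
    ultimately show ?thesis
      using c0 by (simp add: norm_mult norm_divide field_simps)
  qed
  have "cmod ((A *\<^sub>v x) \<bullet>c x) \<le> cmod e * Re (x \<bullet>c x)"
  proof (rule tendsto_lowerbound)
    show "((\<lambda>c. c * Re (x \<bullet>c x)) \<longlongrightarrow> cmod e * Re (x \<bullet>c x)) (at_right (cmod e))"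
      by (intro tendsto_intros)
    show "eventually (\<lambda>c. cmod ((A *\<^sub>v x) \<bullet>c x) \<le> c * Re (x \<bullet>c x)) (at_right (cmod e))"
      using le by (auto simp: eventually_at_filter)
  qed simp
  with e show ?thesis
    using that by blast
qed

section \<open>Trace and the multiset of eigenvalues\<close>

lemma similar_mat_wit_trace:
  assumes "similar_mat_wit A B P Q" "A \<in> carrier_mat n n"
  shows "(\<Sum>i = 0..<n. A $$ (i, i)) = (\<Sum>i = 0..<n. B $$ (i, i) :: 'a :: comm_ring_1)"
proof -
  have B: "B \<in> carrier_mat n n" and P: "P \<in> carrier_mat n n" and Q: "Q \<in> carrier_mat n n"
    and QP: "Q * P = 1\<^sub>m n" and "A = P * B * Q"
    using similar_mat_witD2[OF assms(2,1)] by blast+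
  then have AB: "A = P * (B * Q)"
    by (simp add: assoc_mult_mat[OF P B Q])
  have trace_mult: "(\<Sum>i = 0..<n. (X * Y) $$ (i, i)) = (\<Sum>i = 0..<n. (Y * X) $$ (i, i))"
    if "X \<in> carrier_mat n n" "Y \<in> carrier_mat n n" for X Y :: "'a mat"
  proof -
    have "(\<Sum>i = 0..<n. (X * Y) $$ (i, i)) = (\<Sum>i = 0..<n. \<Sum>j = 0..<n. X $$ (i, j) * Y $$ (j, i))"
      using that by (simp add: scalar_prod_def)
    also have "\<dots> = (\<Sum>j = 0..<n. \<Sum>i = 0..<n. X $$ (i, j) * Y $$ (j, i))"
      by (rule sum.swap)
    also have "\<dots> = (\<Sum>i = 0..<n. (Y * X) $$ (i, i))"
      using that by (simp add: scalar_prod_def mult.commute)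
    finally show ?thesis .
  qed
  have "B * Q * P = B"
    using B Q P QP by (simp add: assoc_mult_mat[OF B Q P])
  moreover have "(\<Sum>i = 0..<n. (P * (B * Q)) $$ (i, i)) = (\<Sum>i = 0..<n. (B * Q * P) $$ (i, i))"
    using B Q P by (intro trace_mult) auto
  ultimately show ?thesis
    using AB by metis
qed

text \<open>By Schur decomposition \<open>A\<close> is similar to an upper triangular matrix, whose
  diagonal is the list of roots of the characteristic polynomial with multiplicities. Similarity
  preserves the trace, which is therefore the sum of the roots.\<close>

lemma proots_char_poly:
  fixes A :: "complex mat"
  assumes A: "A \<in> carrier_mat n n"
  shows "size (proots (char_poly A)) = n"
    and "(\<Sum>z\<in>#proots (char_poly A). z) = (\<Sum>i = 0..<n. A $$ (i, i))"
    and "z \<in># proots (char_poly A) \<longleftrightarrow> eigenvalue A z"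
proof -
  obtain es where es: "char_poly A = (\<Prod>a\<leftarrow>es. [:- a, 1:])"
    using char_poly_factorized[OF A] by blast
  obtain B where B: "B \<in> carrier_mat n n" "upper_triangular B" "similar_mat A B"
    using schur_decomposition_exists[OF A es] by blast
  have char: "char_poly A = (\<Prod>a\<leftarrow>diag_mat B. [:- a, 1:])"
    using char_poly_similar[OF B(3)] char_poly_upper_triangular[OF B(1,2)] by simp
  have "(\<Prod>a\<leftarrow>xs. [:- a, 1:]) \<noteq> 0" for xs :: "complex list"
    by (auto simp: prod_list_zero_iff)
  then have "proots (\<Prod>a\<leftarrow>xs. [:- a, 1:]) = mset xs" for xs :: "complex list"
    by (induction xs) (auto simp: proots_mult simp del: mult_pCons_left)
  then have proots: "proots (char_poly A) = mset (diag_mat B)"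
    by (simp add: char)
  show "size (proots (char_poly A)) = n"
    using B(1) by (simp add: proots diag_mat_def)
  obtain P Q where "similar_mat_wit A B P Q"
    using B(3) unfolding similar_mat_def by blast
  then show "(\<Sum>z\<in>#proots (char_poly A). z) = (\<Sum>i = 0..<n. A $$ (i, i))"
    using similar_mat_wit_trace[OF _ A] B(1)
    by (simp add: proots diag_mat_def sum_unfold_sum_mset)
  have "char_poly A \<noteq> 0"
    using degree_monic_char_poly[OF A] by auto
  then show "z \<in># proots (char_poly A) \<longleftrightarrow> eigenvalue A z"
    using eigenvalue_root_char_poly[OF A] by simp
qed

lemma norm_le_sum_mset_norm: "cmod (\<Sum>z\<in>#M. z) \<le> (\<Sum>z\<in>#M. cmod z)"
  by (induction M) (auto intro: order.trans[OF norm_triangle_ineq])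

text \<open>The other elements sum to \<open>-e\<close>, so by the triangle inequality their moduli
  contribute at least \<open>cmod e\<close> once more.\<close>

lemma twice_norm_le_sum_mset_norm:
  assumes "(\<Sum>z\<in>#M. z) = 0" "e \<in># M"
  shows "2 * cmod e \<le> (\<Sum>z\<in>#M. cmod z)"
proof -
  obtain M' where M: "M = add_mset e M'"
    using assms(2) by (metis insert_DiffM)
  have "e = - (\<Sum>z\<in>#M'. z)"
    using assms(1) by (simp add: M add_eq_0_iff)
  then have "cmod e = cmod (\<Sum>z\<in>#M'. z)"
    by simp
  then show ?thesis
    using norm_le_sum_mset_norm[of M'] by (simp add: M)
qed

section \<open>Undirected trees\<close>

lemma walk_gain_simps [simp]:
  "walk_gain \<phi> [] = 1" "walk_gain \<phi> (e # p) = \<phi> e * walk_gain \<phi> p"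
  "walk_gain \<phi> (p @ q) = walk_gain \<phi> p * walk_gain \<phi> q"
  by (simp_all add: walk_gain_def)

lemma edge_set_simps [simp]:
  "edge_set [] = {}" "edge_set (e # p) = insert {fst e, snd e} (edge_set p)"
  "edge_set (p @ q) = edge_set p \<union> edge_set q"
  by (auto simp: edge_set_def case_prod_unfold)

lemma edge_set_rev_path [simp]: "edge_set (rev_path p) = edge_set p"
  by (induction p) auto

lemma doubleton_in_edge_set_iff: "{u, v} \<in> edge_set p \<longleftrightarrow> (u, v) \<in> set p \<or> (v, u) \<in> set p"
  by (force simp: edge_set_def doubleton_eq_iff)

lemma add_edge_simps [simp]:
  "pverts (add_edge T e) = pverts T" "parcs (add_edge T e) = parcs T \<union> {e, prod.swap e}"
  by (simp_all add: add_edge_def)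

section \<open>Paths and cycles as lists of arcs\<close>

context pair_wf_digraph
begin

lemma apath_self_iff: "apath u p u \<longleftrightarrow> p = [] \<and> u \<in> pverts G"
  using apath_nonempty_ends[of u p u] by (cases "p = []") (auto simp: apath_Nil_iff)

lemma apath_appendD:
  assumes "apath u (p @ q) w" "awalk u p v"
  shows "apath u p v" "apath v q w"
proof -
  have "last (pawalk_verts u p) = v"
    using assms(2) by blast
  then show "apath u p v" "apath v q w"
    using assms(1) by (auto simp: apath_append_iff)
qed

lemma apath_snoc:
  assumes "apath u p v" "(v, w) \<in> parcs G" "w \<notin> set (pawalk_verts u p)"
  shows "apath u (p @ [(v, w)]) w"
proof -
  have last: "last (pawalk_verts u p) = v"
    using awalkI_apath[OF assms(1)] by blast
  then have "v \<in> set (pawalk_verts u p)"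
    using awalk_verts_non_Nil last_in_set by metis
  with last show ?thesis
    using assms wellformed' by (auto simp: apath_append_iff apath_simps)
qed

text \<open>Such an arc splits \<open>p\<close> into a path from \<open>u\<close> to
  \<open>u\<close> before it and one from \<open>v\<close> to \<open>v\<close> after it, both
  empty.\<close>

lemma apath_ends_arc:
  assumes "apath u p v" "(u, v) \<in> set p"
  shows "p = [(u, v)]"
proof -
  obtain p1 p2 where p: "p = p1 @ (u, v) # p2"
    using assms(2) by (auto simp: in_set_conv_decomp)
  have "apath u p1 u" "apath v p2 v"
    using assms(1) unfolding p by (auto simp: apath_append_iff apath_Cons_iff)
  then show ?thesis
    by (simp add: p apath_self_iff)
qed

text \<open>From this arc on, \<open>p\<close> would be a nonempty path from \<open>v\<close> back
  to \<open>v\<close>.\<close>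

lemma apath_ends_reversed_arc:
  assumes "apath u p v"
  shows "(v, u) \<notin> set p"
proof
  assume "(v, u) \<in> set p"
  then obtain p1 p2 where p: "p = p1 @ (v, u) # p2"
    by (auto simp: in_set_conv_decomp)
  have "apath v ((v, u) # p2) v"
    using assms unfolding p apath_append_iff by (auto simp: apath_Cons_iff)
  then show False
    by (simp add: apath_self_iff)
qed

text \<open>Distinctness is expressed by the heads of the arcs, which do not refer to the base
  point; rotating a cycle then only permutes them.\<close>

lemma oriented_cycle_iff:
  "oriented_cycle G p \<longleftrightarrow> (\<exists>u. awalk u p u \<and> distinct (map snd p) \<and> 3 \<le> length p)"
proof -
  have "tl (pawalk_verts u p) = map snd p" if "awalk u p u" for u
  proof -
    have "pawalk_verts u p = (if p = [] then [u] else fst (hd p) # map snd p)"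
      using that by (intro awalk_verts_conv') blast
    then show ?thesis by auto
  qed
  then show ?thesis
    unfolding oriented_cycle_def cycle_def by auto
qed

text \<open>Removing one arc opens a cycle into a path. The vertices that a cycle requires to be
  distinct, all but the first of its vertex list, are exactly those of this path.\<close>

lemma oriented_cycle_Cons_iff:
  "oriented_cycle G ((u, v) # q) \<longleftrightarrow> (u, v) \<in> parcs G \<and> apath v q u \<and> 2 \<le> length q"
  unfolding oriented_cycle_def cycle_def apath_def by (auto simp: awalk_Cons_iff)

lemma oriented_cycle_rotate: "oriented_cycle G (p @ q) \<Longrightarrow> oriented_cycle G (q @ p)"
proof -
  assume "oriented_cycle G (p @ q)"
  then obtain u where u: "awalk u (p @ q) u" "distinct (map snd (p @ q))" "3 \<le> length (p @ q)"
    unfolding oriented_cycle_iff by blast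
  have "awalk (last (pawalk_verts u p)) (q @ p) (last (pawalk_verts u p))"
    using u(1) by (intro awalk_appendI[of _ q u]) simp_all
  moreover have "distinct (map snd (q @ p))" "3 \<le> length (q @ p)"
    using u(2,3) by auto
  ultimately show "oriented_cycle G (q @ p)"
    unfolding oriented_cycle_iff by blast
qed

end

lemma oriented_cycle_mono:
  assumes "pair_wf_digraph G" "pair_wf_digraph H"
    and "oriented_cycle G p" "set p \<subseteq> parcs H"
  shows "oriented_cycle H p"
proof -
  interpret G: pair_wf_digraph G by fact
  interpret H: pair_wf_digraph H by fact
  obtain u where u: "G.awalk u p u" "distinct (map snd p)" "3 \<le> length p"
    using assms(3) G.oriented_cycle_iff by blast
  then obtain e q where p: "p = e # q"
    by (cases p) auto
  then have "u = fst e"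
    using u(1) by (simp add: G.awalk_Cons_iff)
  then have "u \<in> pverts H"
    using assms(4) p H.arc_fst_in_verts by auto
  then have "H.awalk u p u"
    using u(1) assms(4) by (auto simp: G.awalk_def H.awalk_def)
  with u show ?thesis
    by (auto simp: H.oriented_cycle_iff)
qed

lemma (in pair_graph) pair_graph_add_edge:
  assumes "u \<in> pverts G" "v \<in> pverts G" "u \<noteq> v"
  shows "pair_graph (add_edge G (u, v))"
proof
  show "symmetric (with_proj (add_edge G (u, v)))"
    using arcs_symmetric by (auto simp: symmetric_def sym_def)
qed (use assms in \<open>auto dest: wellformed' no_loops'\<close>)

locale undirected_pair_tree = pair_graph T for T :: "'a pair_pre_digraph" +
  assumes tree_connected: "Digraph_Component.connected (with_proj T)"
    and tree_acyclic: "\<not> oriented_cycle T p"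

lemma undirected_tree_iff: "undirected_tree T \<longleftrightarrow> undirected_pair_tree T"
  by (auto simp: undirected_tree_def undirected_pair_tree_def undirected_pair_tree_axioms_def)

context undirected_pair_tree
begin

text \<open>If two paths leave \<open>u\<close> along different arcs, then their remainders join the two successors
  of \<open>u\<close> by a path avoiding \<open>u\<close>, which closes up to a cycle through \<open>u\<close>.\<close>

lemma apath_unique: "apath u p v \<Longrightarrow> apath u q v \<Longrightarrow> p = q"
proof (induction p arbitrary: u q)
  case Nil
  then show ?case
    by (simp add: apath_Nil_iff apath_self_iff)
next
  case (Cons e p)
  obtain x where e: "e = (u, x)"
    using Cons.prems(1) by (cases e) (auto simp: apath_Cons_iff)
  have p: "(u, x) \<in> parcs T" "apath x p v" "u \<notin> set (pawalk_verts x p)"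
    using Cons.prems(1) by (auto simp: e apath_Cons_iff)
  have "u \<noteq> v"
    using Cons.prems(1) apath_self_iff by blast
  then obtain e' q' where q: "q = e' # q'"
    using Cons.prems(2) by (cases q) (auto simp: apath_Nil_iff)
  obtain y where e': "e' = (u, y)"
    using Cons.prems(2) by (cases e') (auto simp: q apath_Cons_iff)
  have q': "(u, y) \<in> parcs T" "apath y q' v" "u \<notin> set (pawalk_verts y q')"
    using Cons.prems(2) by (auto simp: q e' apath_Cons_iff)
  have "x = y"
  proof (rule ccontr)
    assume "x \<noteq> y"
    let ?w = "p @ rev_path q'"
    have walks: "awalk x p v" "awalk v (rev_path q') y" "awalk y q' v"
      using p(2) q'(2) by (simp_all add: apath_def)
    then have w: "awalk x ?w y"
      using awalk_appendI by blast
    \<comment> \<open>The walk through \<open>v\<close> may repeat vertices, for instance where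
      \<open>p\<close> and \<open>q'\<close> share a final segment. Shortening it to a path
      introduces no new arcs, so \<open>u\<close> is still avoided.\<close>
    define s where "s = awalk_to_apath ?w"
    have s: "apath x s y"
      unfolding s_def using w by (rule apath_awalk_to_apath)
    have "set s \<subseteq> set ?w"
      unfolding s_def using w by (rule awalk_to_apath_subset)
    then have "set (pawalk_verts x s) \<subseteq> set (pawalk_verts x ?w)"
      using set_awalk_verts[OF w] set_awalk_verts[OF awalkI_apath[OF s]] by auto
    moreover have "set (pawalk_verts x ?w) = set (pawalk_verts x p) \<union> set (pawalk_verts y q')"
      using set_awalk_verts_append[OF walks(1,2)] awalk_verts_rev_path[OF walks(3)] by simp
    ultimately have u: "u \<notin> set (pawalk_verts x s)"
      using p(3) q'(3) by auto
    have "s \<noteq> []"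
      using s \<open>x \<noteq> y\<close> by (auto simp: apath_Nil_iff)
    moreover have "apath x (s @ [(y, u)]) u"
      using s arcs_symmetric[OF q'(1)] u by (rule apath_snoc)
    ultimately have "oriented_cycle T ((u, x) # s @ [(y, u)])"
      using p(1) by (cases s) (auto simp: oriented_cycle_Cons_iff)
    then show False
      using tree_acyclic by blast
  qed
  then show ?case
    using Cons.IH[OF p(2)] q'(2) by (simp add: e e' q)
qed

section \<open>Tree paths, parents and the number of tree arcs\<close>

definition tree_path :: "'a \<Rightarrow> 'a \<Rightarrow> ('a \<times> 'a) list" where
  "tree_path u v = (THE p. apath u p v)"

lemma tree_path_eq: "apath u p v \<Longrightarrow> tree_path u v = p"
  unfolding tree_path_def using apath_unique by blast

lemma apath_tree_path:
  assumes "u \<in> pverts T" "v \<in> pverts T"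
  shows "apath u (tree_path u v) v"
proof -
  have "strongly_connected (with_proj T)"
    using tree_connected symmetric_connected_imp_strongly_connected sym_arcs by blast
  then have "\<exists>p. apath u p v"
    using assms unfolding strongly_connected_def reachable_apath[symmetric] by auto
  then show ?thesis
    using tree_path_eq by auto
qed

lemma tree_path_rev:
  assumes "u \<in> pverts T" "v \<in> pverts T"
  shows "tree_path v u = rev_path (tree_path u v)"
  using assms by (intro tree_path_eq) (simp add: apath_tree_path)

text \<open>If \<open>v\<close> lies on the path to \<open>u\<close>, the rest of that path from
  \<open>v\<close> is the single arc \<open>(v, u)\<close> by uniqueness; otherwise the path to
  \<open>u\<close> extends to \<open>v\<close>. So one end of every tree edge is the parent of the
  other.\<close>

lemma tree_path_arc:
  assumes r: "r \<in> pverts T" and e: "(u, v) \<in> parcs T"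
  shows "tree_path r v = tree_path r u @ [(u, v)] \<or> tree_path r u = tree_path r v @ [(v, u)]"
proof -
  have uv: "u \<in> pverts T" "v \<in> pverts T"
    using e wellformed' by auto
  let ?p = "tree_path r u"
  have p: "apath r ?p u"
    using r uv(1) by (rule apath_tree_path)
  show ?thesis
  proof (cases "v \<in> set (pawalk_verts r ?p)")
    case True
    then obtain q s where qs: "?p = q @ s" "awalk r q v"
      using awalk_decomp[OF awalkI_apath[OF p]] by blast
    then have "apath r q v" "apath v s u"
      using p apath_appendD[of r q s u v] by simp_all
    moreover have "apath v [(v, u)] u"
      using e uv arcs_symmetric no_loops' by (auto simp: apath_simps)
    ultimately show ?thesis
      using qs(1) apath_unique tree_path_eq by metis
  next
    case False
    then have "apath r (?p @ [(u, v)]) v"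
      using p e by (intro apath_snoc)
    then show ?thesis
      using tree_path_eq by blast
  qed
qed

lemma tree_path_last_arc:
  assumes "r \<in> pverts T" "v \<in> pverts T" "v \<noteq> r"
  obtains u where "(u, v) \<in> parcs T" "tree_path r v = tree_path r u @ [(u, v)]"
proof -
  have p: "apath r (tree_path r v) v"
    using assms by (simp add: apath_tree_path)
  then have "tree_path r v \<noteq> []"
    using assms(3) by (auto simp: apath_Nil_iff)
  then obtain q e where q: "tree_path r v = q @ [e]"
    by (metis rev_exhaust)
  obtain u w where "e = (u, w)"
    by (cases e)
  then have "apath r q u" "(u, v) \<in> parcs T" "e = (u, v)"
    using p unfolding q by (auto simp: apath_append_iff apath_simps)
  then show ?thesis
    using that q tree_path_eq by blast
qed

text \<open>Each vertex other than the root contributes the arc from its parent and the reverse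
  arc.\<close>

lemma card_parcs_ge: "2 * (card (pverts T) - 1) \<le> card (parcs T)"
proof (cases "pverts T = {}")
  case False
  then obtain r where r: "r \<in> pverts T"
    by blast
  let ?V = "pverts T - {r}"
  have "\<exists>u. (u, v) \<in> parcs T \<and> tree_path r v = tree_path r u @ [(u, v)]" if "v \<in> ?V" for v
    using tree_path_last_arc[OF r, of v] that by blast
  then obtain par where par: "\<And>v. v \<in> ?V \<Longrightarrow> (par v, v) \<in> parcs T"
      "\<And>v. v \<in> ?V \<Longrightarrow> tree_path r v = tree_path r (par v) @ [(par v, v)]"
    by metis
  let ?L = "(\<lambda>v. (par v, v)) ` ?V" and ?L' = "(\<lambda>v. (v, par v)) ` ?V"
  have "?L \<inter> ?L' = {}"
  proof (rule ccontr)
    assume "?L \<inter> ?L' \<noteq> {}"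
    then obtain v w where vw: "v \<in> ?V" "w \<in> ?V" "par v = w" "v = par w"
      by blast
    \<comment> \<open>Two vertices cannot be parents of each other, since the root path of a child
      is one arc longer.\<close>
    then have "length (tree_path r v) = length (tree_path r v) + 2"
      using par(2)[of v] par(2)[of w] by simp
    then show False by simp
  qed
  moreover have "card ?L = card (pverts T) - 1" "card ?L' = card (pverts T) - 1"
    using r by (simp_all add: card_image inj_on_def pair_finite_verts)
  ultimately have "card (?L \<union> ?L') = 2 * (card (pverts T) - 1)"
    by (subst card_Un_disjoint) (auto simp: pair_finite_verts)
  moreover have "?L \<union> ?L' \<subseteq> parcs T"
    using par(1) arcs_symmetric by blast
  ultimately show ?thesis
    using card_mono[OF pair_finite_arcs] by metis
qed simp

text \<open>As \<open>T\<close> is acyclic, the cycle uses the new edge in some direction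
  \<open>(a, b)\<close>. Rotated to start there, it continues along a path from \<open>b\<close> to
  \<open>a\<close> inside \<open>T\<close>, hence along the tree path. Rotation preserves the gain
  because multiplication is commutative; the orientation remains open and is recorded by
  \<open>(a, b)\<close>.\<close>

lemma add_edge_cycle:
  assumes uv: "u \<in> pverts T" "v \<in> pverts T" "u \<noteq> v" "(u, v) \<notin> parcs T"
    and cyc: "oriented_cycle (add_edge T (u, v)) p"
  obtains a b where "(a, b) = (u, v) \<or> (a, b) = (v, u)" "edge_set p = edge_set ((a, b) # tree_path b a)"
    "\<And>\<phi>. walk_gain \<phi> p = walk_gain \<phi> ((a, b) # tree_path b a)"
proof -
  interpret H: pair_graph "add_edge T (u, v)"
    using uv by (intro pair_graph_add_edge)
  have "\<not> set p \<subseteq> parcs T"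
    using oriented_cycle_mono[OF _ _ cyc, of T] tree_acyclic H.pair_wf_digraph pair_wf_digraph by blast
  moreover have "set p \<subseteq> parcs (add_edge T (u, v))"
    using cyc H.oriented_cycle_iff by (auto simp: H.awalk_def)
  ultimately obtain e where "e \<in> set p" "e = (u, v) \<or> e = (v, u)"
    by auto
  then obtain a b where ab: "(a, b) = (u, v) \<or> (a, b) = (v, u)" "(a, b) \<in> set p"
    by (cases e) auto
  then obtain p1 p2 where p: "p = p1 @ (a, b) # p2"
    by (auto simp: in_set_conv_decomp)
  define q where "q = p2 @ p1"
  have "oriented_cycle (add_edge T (u, v)) ((a, b) # q)"
    using cyc H.oriented_cycle_rotate[of p1 "(a, b) # p2"] by (simp add: p q_def)
  then have q: "H.apath b q a" "2 \<le> length q"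
    by (simp_all add: H.oriented_cycle_Cons_iff)
  \<comment> \<open>The arc \<open>(b, a)\<close> would be all of \<open>q\<close>, which has at
    least two arcs; \<open>(a, b)\<close> would return to the start of \<open>q\<close>.\<close>
  have "(b, a) \<notin> set q" "(a, b) \<notin> set q"
    using q H.apath_ends_arc[of b q a] H.apath_ends_reversed_arc[of b q a] by auto
  then have "set q \<subseteq> parcs T"
    using q(1) ab(1) by (auto simp: H.apath_def H.awalk_def)
  then have "apath b q a"
    using q(1) by (simp add: apath_def awalk_def H.apath_def H.awalk_def)
  then have "q = tree_path b a"
    using tree_path_eq by metis
  then have "edge_set p = edge_set ((a, b) # tree_path b a)"
    "\<And>\<phi>. walk_gain \<phi> p = walk_gain \<phi> ((a, b) # tree_path b a)"
    unfolding \<open>q = tree_path b a\<close>[symmetric] q_def p by (auto simp: mult_ac)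
  with ab(1) that show ?thesis
    by blast
qed

lemma oriented_cycle_add_edge:
  assumes uv: "u \<in> pverts T" "v \<in> pverts T" "u \<noteq> v" "(u, v) \<notin> parcs T"
  shows "oriented_cycle (add_edge T (u, v)) ((u, v) # tree_path v u)"
proof -
  interpret H: pair_graph "add_edge T (u, v)"
    using uv by (intro pair_graph_add_edge)
  have p: "apath v (tree_path v u) u"
    using uv by (simp add: apath_tree_path)
  have "tree_path v u \<noteq> []"
    using p uv(3) by (auto simp: apath_Nil_iff)
  moreover have "tree_path v u \<noteq> [e]" for e
  proof
    assume "tree_path v u = [e]"
    then have "(v, u) \<in> parcs T"
      using p by (cases e) (auto simp: apath_simps)
    then show False
      using uv(4) arcs_symmetric by blast
  qed
  ultimately have "2 \<le> length (tree_path v u)"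
    by (cases "tree_path v u" rule: list_exhaust_NSC) auto
  moreover have "H.apath v (tree_path v u) u"
    using p by (auto simp: apath_def awalk_def H.apath_def H.awalk_def)
  ultimately show ?thesis
    by (simp add: H.oriented_cycle_Cons_iff)
qed

end

section \<open>Spanning trees of gain graphs\<close>

text \<open>The arc count of a complete graph: it bounds \<sigma> and is attained in the equality
  case.\<close>

lemma card_off_diagonal:
  assumes "finite V"
  shows "card (V \<times> V - Id_on V) = card V * (card V - 1)"
proof -
  have "Id_on V = (\<lambda>v. (v, v)) ` V"
    by (auto simp: Id_on_def)
  then have "card (Id_on V) = card V" "finite (Id_on V)"
    using assms by (simp_all add: card_image inj_on_def)
  then show ?thesis
    by (subst card_Diff_subset) (auto simp: Id_on_def card_cartesian_product diff_mult_distrib2)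
qed

locale gain_graph_spanning_tree = gain_graph G \<phi> + T: undirected_pair_tree T
  for G :: "'a pair_pre_digraph" and \<phi> and T :: "'a pair_pre_digraph" +
  fixes r
  assumes tree_verts: "pverts T = pverts G"
    and tree_arcs: "parcs T \<subseteq> parcs G"
    and root: "r \<in> pverts G"
begin

definition potential :: "'a \<Rightarrow> complex" where
  "potential v = walk_gain \<phi> (T.tree_path r v)"

text \<open>Indexed by arcs, so that sums over non-tree arcs can be grouped by cycle; both
  orientations of an edge give the same edge set.\<close>

definition fundamental_cycle :: "'a \<times> 'a \<Rightarrow> 'a set set" where
  "fundamental_cycle e = edge_set (e # T.tree_path (snd e) (fst e))"

lemma gain_nonzero: "e \<in> parcs G \<Longrightarrow> \<phi> e \<noteq> 0"
  using gain_unit by (cases e) fastforce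

lemma norm_walk_gain: "set p \<subseteq> parcs G \<Longrightarrow> cmod (walk_gain \<phi> p) = 1"
  using gain_unit by (induction p) (auto simp: norm_mult)

lemma tree_path_arcs: "u \<in> pverts G \<Longrightarrow> v \<in> pverts G \<Longrightarrow> set (T.tree_path u v) \<subseteq> parcs T"
  using T.apath_tree_path[of u v] tree_verts by (auto simp: T.apath_def T.awalk_def)

lemma norm_potential: "v \<in> pverts G \<Longrightarrow> cmod (potential v) = 1"
  unfolding potential_def using tree_path_arcs[OF root] tree_arcs by (intro norm_walk_gain) blast

lemma potential_nonzero: "v \<in> pverts G \<Longrightarrow> potential v \<noteq> 0"
  using norm_potential[of v] by auto

text \<open>Clear if \<open>u\<close> is the parent of \<open>v\<close>. If \<open>v\<close> is the
  parent of \<open>u\<close>, the path to \<open>u\<close> ends with \<open>(v, u)\<close>, whose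
  gain cancels against that of \<open>(u, v)\<close>.\<close>

lemma potential_tree_arc:
  assumes e: "(u, v) \<in> parcs T"
  shows "potential v = potential u * \<phi> (u, v)"
proof -
  have G: "(u, v) \<in> parcs G"
    using e tree_arcs by blast
  have "r \<in> pverts T"
    by (simp add: tree_verts root)
  from T.tree_path_arc[OF this e] show ?thesis
    using gain_reverse[OF G] gain_nonzero[OF G] by (auto simp: potential_def)
qed

lemma potential_walk: "T.awalk u p v \<Longrightarrow> potential v = potential u * walk_gain \<phi> p"
proof (induction p arbitrary: u)
  case (Cons e p)
  then show ?case
    using potential_tree_arc[of "fst e" "snd e"] by (auto simp: T.awalk_Cons_iff)
qed (simp add: T.awalk_Nil_iff)

lemma walk_gain_tree_path:
  assumes "u \<in> pverts G" "v \<in> pverts G"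
  shows "walk_gain \<phi> (T.tree_path u v) = potential v / potential u"
proof -
  have "T.awalk u (T.tree_path u v) v"
    using assms tree_verts by (intro T.awalkI_apath T.apath_tree_path) auto
  then show ?thesis
    using potential_walk[of u "T.tree_path u v" v] potential_nonzero[OF assms(1)] by simp
qed

section \<open>Fundamental cycles and their gains\<close>

lemma non_tree_arcD:
  assumes "(u, v) \<in> parcs G - parcs T"
  shows "u \<in> pverts T" "v \<in> pverts T" "u \<noteq> v" "(u, v) \<notin> parcs T" "(v, u) \<in> parcs G - parcs T"
  using assms wellformed' no_loops' arcs_symmetric T.arcs_symmetric by (auto simp: tree_verts)

lemma fundamental_cycle_swap:
  assumes "(u, v) \<in> parcs G - parcs T"
  shows "fundamental_cycle (v, u) = fundamental_cycle (u, v)"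
proof -
  have "T.tree_path u v = rev_path (T.tree_path v u)"
    using non_tree_arcD[OF assms] by (intro T.tree_path_rev) auto
  then show ?thesis
    by (simp add: fundamental_cycle_def insert_commute)
qed

text \<open>A fundamental cycle contains only one edge outside the tree, so it determines that edge,
  though not its orientation.\<close>

lemma fundamental_cycle_eq_iff:
  assumes "(u, v) \<in> parcs G - parcs T" "(a, b) \<in> parcs G - parcs T"
  shows "fundamental_cycle (a, b) = fundamental_cycle (u, v) \<longleftrightarrow> (a, b) = (u, v) \<or> (a, b) = (v, u)"
proof
  assume "fundamental_cycle (a, b) = fundamental_cycle (u, v)"
  then have "{a, b} \<in> fundamental_cycle (u, v)"
    by (auto simp: fundamental_cycle_def)
  moreover have "{a, b} \<notin> edge_set (T.tree_path v u)"
    unfolding doubleton_in_edge_set_iff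
    using tree_path_arcs[of v u] non_tree_arcD[OF assms(1)] non_tree_arcD[OF assms(2)]
    by (auto simp: tree_verts)
  ultimately have "{a, b} = {u, v}"
    by (simp add: fundamental_cycle_def)
  then show "(a, b) = (u, v) \<or> (a, b) = (v, u)"
    by (auto simp: doubleton_eq_iff)
qed (use fundamental_cycle_swap[OF assms(1)] in auto)

text \<open>The potentials telescope along the tree path, which gives the stated quotient for one
  orientation and its inverse for the other. The quotient has modulus 1, so its inverse is its
  conjugate and the real parts agree.\<close>

lemma add_edge_cycle_edge_set:
  assumes e: "(u, v) \<in> parcs G - parcs T" and p: "oriented_cycle (add_edge T (u, v)) p"
  shows "edge_set p = fundamental_cycle (u, v)"
    and "Re (walk_gain \<phi> p) = Re (potential u * \<phi> (u, v) / potential v)"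
proof -
  note uv = non_tree_arcD[OF e]
  obtain a b where ab: "(a, b) = (u, v) \<or> (a, b) = (v, u)" and
    es: "edge_set p = edge_set ((a, b) # T.tree_path b a)" and
    wg: "walk_gain \<phi> p = walk_gain \<phi> ((a, b) # T.tree_path b a)"
    using T.add_edge_cycle[OF uv(1-4) p] by metis
  show "edge_set p = fundamental_cycle (u, v)"
    using ab fundamental_cycle_swap[OF e] es by (auto simp: fundamental_cycle_def)
  have V: "u \<in> pverts G" "v \<in> pverts G"
    using uv tree_verts by auto
  have "walk_gain \<phi> p = \<phi> (a, b) * potential a / potential b"
    using V ab by (auto simp: wg walk_gain_tree_path)
  moreover have "Re (\<phi> (v, u) * potential v / potential u) = Re (\<phi> (u, v) * potential u / potential v)"
  proof -
    let ?z = "\<phi> (u, v) * potential u / potential v"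
    have "cmod ?z = 1"
      using V e gain_unit by (simp add: norm_mult norm_divide norm_potential)
    then have "?z * cnj ?z = 1"
      by (simp only: complex_norm_square[symmetric]) simp
    then have "inverse ?z = cnj ?z"
      by (rule inverse_unique)
    moreover have "inverse ?z = \<phi> (v, u) * potential v / potential u"
      using gain_reverse[of u v] e by (simp add: field_simps)
    ultimately have "Re (\<phi> (v, u) * potential v / potential u) = Re (cnj ?z)"
      by simp
    then show ?thesis
      by (simp only: cnj.sel)
  qed
  ultimately show "Re (walk_gain \<phi> p) = Re (potential u * \<phi> (u, v) / potential v)"
    using ab by (auto simp: mult.commute)
qed

lemma fundamental_cycles_eq: "fundamental_cycles G T = fundamental_cycle ` (parcs G - parcs T)"
proof (intro subset_antisym subsetI)
  fix C assume "C \<in> fundamental_cycles G T"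
  then obtain e p where e: "e \<in> parcs G - parcs T" "oriented_cycle (add_edge T e) p" "C = edge_set p"
    unfolding fundamental_cycles_def by blast
  then have "C = fundamental_cycle e"
    using add_edge_cycle_edge_set(1)[of "fst e" "snd e" p] by simp
  with e(1) show "C \<in> fundamental_cycle ` (parcs G - parcs T)"
    by (rule rev_image_eqI)
next
  fix C assume "C \<in> fundamental_cycle ` (parcs G - parcs T)"
  then obtain u v where uv: "(u, v) \<in> parcs G - parcs T" "C = fundamental_cycle (u, v)"
    by auto
  have p: "oriented_cycle (add_edge T (u, v)) ((u, v) # T.tree_path v u)"
    using non_tree_arcD[OF uv(1)] by (intro T.oriented_cycle_add_edge)
  then have "C = edge_set ((u, v) # T.tree_path v u)"
    using uv by (simp add: fundamental_cycle_def)
  then show "C \<in> fundamental_cycles G T"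
    unfolding fundamental_cycles_def using uv(1) p by blast
qed

text \<open>The definite description ranges over cycles of \<open>G\<close>. One with this edge set
  uses only arcs of \<open>T\<close> with the edge \<open>uv\<close> added, so it is a cycle there
  and its real gain is already known.\<close>

lemma re_gain_fundamental_cycle:
  assumes e: "(u, v) \<in> parcs G - parcs T"
  shows "re_gain G \<phi> (fundamental_cycle (u, v)) = Re (potential u * \<phi> (u, v) / potential v)"
  unfolding re_gain_def
proof (rule the_equality)
  note uv = non_tree_arcD[OF e]
  interpret H: pair_graph "add_edge T (u, v)"
    using uv by (intro T.pair_graph_add_edge)
  let ?p = "(u, v) # T.tree_path v u"
  have p: "oriented_cycle (add_edge T (u, v)) ?p"
    using uv by (intro T.oriented_cycle_add_edge)
  have "set ?p \<subseteq> parcs G"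
    using e tree_path_arcs[of v u] uv(1,2) tree_arcs tree_verts by auto
  then have "oriented_cycle G ?p"
    using oriented_cycle_mono[OF H.pair_wf_digraph pair_wf_digraph p] by blast
  then show "\<exists>p. oriented_cycle G p \<and> edge_set p = fundamental_cycle (u, v) \<and>
      Re (potential u * \<phi> (u, v) / potential v) = Re (walk_gain \<phi> p)"
    using add_edge_cycle_edge_set[OF e p] by metis
  fix x
  assume "\<exists>p. oriented_cycle G p \<and> edge_set p = fundamental_cycle (u, v) \<and> x = Re (walk_gain \<phi> p)"
  then obtain p where p: "oriented_cycle G p" "edge_set p = fundamental_cycle (u, v)"
      "x = Re (walk_gain \<phi> p)"
    by blast
  have "set p \<subseteq> parcs (add_edge T (u, v))"
  proof
    fix e assume "e \<in> set p"
    moreover obtain a b where ab: "e = (a, b)"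
      by (cases e)
    ultimately have "{a, b} \<in> fundamental_cycle (u, v)"
      using doubleton_in_edge_set_iff p(2) by metis
    then have "{a, b} = {u, v} \<or> (a, b) \<in> set (T.tree_path v u) \<or> (b, a) \<in> set (T.tree_path v u)"
      by (simp add: fundamental_cycle_def doubleton_in_edge_set_iff)
    moreover have "set (T.tree_path v u) \<subseteq> parcs T"
      using tree_path_arcs uv(1,2) tree_verts by simp
    ultimately show "e \<in> parcs (add_edge T (u, v))"
      using ab T.arcs_symmetric by (auto simp: doubleton_eq_iff)
  qed
  then have "oriented_cycle (add_edge T (u, v)) p"
    using oriented_cycle_mono[OF pair_wf_digraph H.pair_wf_digraph p(1)] by blast
  then show "x = Re (potential u * \<phi> (u, v) / potential v)"
    using add_edge_cycle_edge_set(2)[OF e] p(3) by simp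
qed

text \<open>Tree arcs contribute 1 each, and the non-tree arcs with a given fundamental cycle are
  the two orientations of one edge. The number of tree arcs is left open: the bound needs it from
  below, the equality case from above.\<close>

lemma sum_gauged_gains:
  "(\<Sum>(u, v)\<in>parcs G. Re (potential u * \<phi> (u, v) / potential v)) =
    real (card (parcs T)) + 2 * (\<Sum>C\<in>fundamental_cycles G T. re_gain G \<phi> C)"
proof -
  let ?N = "parcs G - parcs T" and ?g = "\<lambda>(u, v). Re (potential u * \<phi> (u, v) / potential v)"
  have "sum ?g ?N = (\<Sum>e\<in>?N. re_gain G \<phi> (fundamental_cycle e))"
    by (intro sum.cong refl) (auto simp: re_gain_fundamental_cycle)
  also have "\<dots> = (\<Sum>C\<in>fundamental_cycle ` ?N.
      \<Sum>e | e \<in> ?N \<and> fundamental_cycle e = C. re_gain G \<phi> (fundamental_cycle e))"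
    using pair_finite_arcs by (intro sum.image_gen) auto
  also have "\<dots> = (\<Sum>C\<in>fundamental_cycle ` ?N. 2 * re_gain G \<phi> C)"
  proof (intro sum.cong refl)
    fix C assume "C \<in> fundamental_cycle ` ?N"
    then obtain u v where uv: "(u, v) \<in> ?N" "C = fundamental_cycle (u, v)"
      by auto
    have "{e. e \<in> ?N \<and> fundamental_cycle e = C} = {(u, v), (v, u)}"
      using uv fundamental_cycle_eq_iff[OF uv(1)] non_tree_arcD(5)[OF uv(1)] by auto
    then show "(\<Sum>e | e \<in> ?N \<and> fundamental_cycle e = C. re_gain G \<phi> (fundamental_cycle e)) =
        2 * re_gain G \<phi> C"
      using non_tree_arcD(3)[OF uv(1)] fundamental_cycle_swap[OF uv(1)] by (simp add: uv(2))
  qed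
  also have "\<dots> = 2 * (\<Sum>C\<in>fundamental_cycles G T. re_gain G \<phi> C)"
    by (simp add: fundamental_cycles_eq sum_distrib_left)
  finally have N: "sum ?g ?N = \<dots>" .
  have "sum ?g (parcs T) = (\<Sum>e\<in>parcs T. 1)"
  proof (intro sum.cong refl)
    fix e assume "e \<in> parcs T"
    moreover obtain u v where "e = (u, v)"
      by (cases e)
    ultimately show "?g e = 1"
      using potential_tree_arc[of u v] potential_nonzero[of v] T.in_arcsD2[of u v] tree_verts by auto
  qed
  then show ?thesis
    using N sum.subset_diff[OF tree_arcs pair_finite_arcs, of ?g] by simp
qed

section \<open>The energy estimate\<close>

lemma sum_gauged_gains_le:
  "(\<Sum>(u, v)\<in>parcs G. Re (potential u * \<phi> (u, v) / potential v)) \<le> real (card (pverts G) * (card (pverts G) - 1))"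
proof -
  have "parcs G \<subseteq> pverts G \<times> pverts G - Id_on (pverts G)"
    using wellformed' no_loops' by fastforce
  then have "card (parcs G) \<le> card (pverts G \<times> pverts G - Id_on (pverts G))"
    using pair_finite_verts by (intro card_mono) auto
  also have "\<dots> = card (pverts G) * (card (pverts G) - 1)"
    using pair_finite_verts by (rule card_off_diagonal)
  finally have "real (card (parcs G)) \<le> real (card (pverts G) * (card (pverts G) - 1))"
    by (simp only: of_nat_le_iff)
  moreover have "(\<Sum>(u, v)\<in>parcs G. Re (potential u * \<phi> (u, v) / potential v)) \<le> (\<Sum>e\<in>parcs G. 1)"
  proof (intro sum_mono, clarify)
    fix u v assume e: "(u, v) \<in> parcs G"
    have "Re (potential u * \<phi> (u, v) / potential v) \<le> cmod (potential u * \<phi> (u, v) / potential v)"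
      by (rule complex_Re_le_cmod)
    also have "\<dots> = 1"
      using gain_unit[OF e] wellformed'[OF e] by (simp add: norm_mult norm_divide norm_potential)
    finally show "Re (potential u * \<phi> (u, v) / potential v) \<le> 1" .
  qed
  moreover have "(\<Sum>e\<in>parcs G. 1) = real (card (parcs G))"
    by simp
  ultimately show ?thesis
    by linarith
qed

lemma energy_ge:
  assumes vs: "distinct vs" "set vs = pverts G"
  shows "2 * (\<Sum>(u, v)\<in>parcs G. Re (potential u * \<phi> (u, v) / potential v))
    \<le> real (card (pverts G)) * energy G \<phi> vs"
proof -
  define n where "n = length vs"
  have n: "n = card (pverts G)"
    using vs distinct_card n_def by metis
  have n0: "n > 0"
    using root vs(2) by (auto simp: n_def)
  let ?A = "adjacency G \<phi> vs"
  have A: "?A \<in> carrier_mat n n"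
    by (simp add: adjacency_def n_def)
  have entry: "?A $$ (p, q) = (if (vs ! p, vs ! q) \<in> parcs G then \<phi> (vs ! p, vs ! q) else 0)"
    if "p < n" "q < n" for p q
    using that by (simp add: adjacency_def n_def)
  have vert: "vs ! p \<in> pverts G" if "p < n" for p
    using that vs(2) nth_mem by (auto simp: n_def)
  \<comment> \<open>The entries are conjugated so that the form of the unscaled matrix at
    \<open>x\<close> has the terms \<open>potential u * \<phi> (u, v) / potential v\<close>. They
    have modulus 1, so the squared norm of \<open>x\<close> is \<open>n\<close>.\<close>
  define x where "x = vec n (\<lambda>p. cnj (potential (vs ! p)))"
  have x: "x \<in> carrier_vec n"
    by (simp add: x_def)
  have herm: "?A $$ (q, p) = cnj (?A $$ (p, q))" if "p < n" "q < n" for p q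
  proof (cases "(vs ! p, vs ! q) \<in> parcs G")
    case True
    have "\<phi> (vs ! p, vs ! q) * cnj (\<phi> (vs ! p, vs ! q)) = 1"
      using gain_unit[OF True] by (simp only: complex_norm_square[symmetric]) simp
    then have "inverse (\<phi> (vs ! p, vs ! q)) = cnj (\<phi> (vs ! p, vs ! q))"
      by (rule inverse_unique)
    then show ?thesis
      using that True arcs_symmetric[OF True] gain_reverse[OF True] by (simp add: entry)
  next
    case False
    then have "(vs ! q, vs ! p) \<notin> parcs G"
      using arcs_symmetric by blast
    then show ?thesis
      using that False by (simp add: entry)
  qed
  obtain e where e: "eigenvalue ?A e" "cmod ((?A *\<^sub>v x) \<bullet>c x) \<le> cmod e * Re (x \<bullet>c x)"
    using hermitian_quadratic_form_le_eigenvalue[OF A n0 x herm] by blast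
  have "(\<Sum>i = 0..<n. ?A $$ (i, i)) = 0"
    using no_loops' by (intro sum.neutral) (auto simp: entry)
  then have "2 * cmod e \<le> energy G \<phi> vs"
    unfolding energy_def using e(1) proots_char_poly[OF A]
    by (intro twice_norm_le_sum_mset_norm) auto
  moreover have "Re (x \<bullet>c x) = n"
    by (simp add: cscalar_prod_self x_def norm_potential vert)
  moreover have "(\<Sum>(u, v)\<in>parcs G. Re (potential u * \<phi> (u, v) / potential v)) = Re ((?A *\<^sub>v x) \<bullet>c x)"
  proof -
    let ?f = "\<lambda>(u, v). if (u, v) \<in> parcs G then potential u * \<phi> (u, v) / potential v else 0"
    have bij: "bij_betw ((!) vs) {0..<n} (pverts G)"
      using bij_betw_nth[OF vs(1)] vs(2) by (auto simp: n_def atLeast0LessThan)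
    have cnj: "cnj (potential v) = 1 / potential v" if "v \<in> pverts G" for v
    proof -
      have "potential v * cnj (potential v) = 1"
        using norm_potential[OF that] by (simp only: complex_norm_square[symmetric]) simp
      then show ?thesis
        using potential_nonzero[OF that] by (simp add: field_simps)
    qed
    have "(?A *\<^sub>v x) \<bullet>c x = (\<Sum>p = 0..<n. \<Sum>q = 0..<n. ?A $$ (p, q) * x $ q * cnj (x $ p))"
      using A x by (simp add: scalar_prod_def sum_distrib_right)
    also have "\<dots> = (\<Sum>p = 0..<n. \<Sum>q = 0..<n. ?f (vs ! p, vs ! q))"
      using vert by (intro sum.cong refl) (simp add: entry x_def cnj)
    also have "\<dots> = (\<Sum>p = 0..<n. \<Sum>v\<in>pverts G. ?f (vs ! p, v))"
      by (intro sum.cong refl sum.reindex_bij_betw[OF bij, of "\<lambda>v. ?f (vs ! _, v)"])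
    also have "\<dots> = (\<Sum>u\<in>pverts G. \<Sum>v\<in>pverts G. ?f (u, v))"
      by (rule sum.reindex_bij_betw[OF bij, of "\<lambda>u. \<Sum>v\<in>pverts G. ?f (u, v)"])
    also have "\<dots> = sum ?f (pverts G \<times> pverts G)"
      by (simp add: sum.cartesian_product)
    also have "\<dots> = sum ?f (parcs G)"
      using wellformed' pair_finite_verts by (intro sum.mono_neutral_right) auto
    also have "\<dots> = (\<Sum>(u, v)\<in>parcs G. potential u * \<phi> (u, v) / potential v)"
      by (intro sum.cong) auto
    finally show ?thesis
      by (simp add: case_prod_unfold)
  qed
  ultimately have "2 * (\<Sum>(u, v)\<in>parcs G. Re (potential u * \<phi> (u, v) / potential v)) \<le> 2 * (cmod e * n)"
    using e(2) complex_Re_le_cmod[of "(?A *\<^sub>v x) \<bullet>c x"] by simp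
  also have "\<dots> \<le> real n * energy G \<phi> vs"
    using mult_left_mono[OF \<open>2 * cmod e \<le> energy G \<phi> vs\<close>, of "real n"] by (simp add: mult_ac)
  finally show ?thesis
    by (simp add: n)
qed

theorem energy_lower_bound:
  assumes vs: "distinct vs" "set vs = pverts G" and n: "n = card (pverts G)"
  shows "2 * (\<Sum>C\<in>fundamental_cycles G T. re_gain G \<phi> C) + (5 * real n - (real n)\<^sup>2 - 4) \<le> energy G \<phi> vs"
proof -
  define \<sigma> where "\<sigma> = (\<Sum>(u, v)\<in>parcs G. Re (potential u * \<phi> (u, v) / potential v))"
  have n1: "n \<ge> 1"
    using root pair_finite_verts n by (metis card_0_eq empty_iff less_one not_le)
  have E: "2 * \<sigma> \<le> n * energy G \<phi> vs"
    using energy_ge[OF vs] by (simp add: \<sigma>_def n)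
  have "\<sigma> \<le> real (n * (n - 1))"
    using sum_gauged_gains_le by (simp add: \<sigma>_def n)
  then have le: "\<sigma> \<le> real n * (real n - 1)"
    using n1 by (simp add: of_nat_diff)
  have "real (2 * (n - 1)) \<le> real (card (parcs T))"
    using T.card_parcs_ge unfolding n tree_verts of_nat_le_iff .
  then have S: "2 * (\<Sum>C\<in>fundamental_cycles G T. re_gain G \<phi> C) \<le> \<sigma> - 2 * (real n - 1)"
    using sum_gauged_gains n1 by (simp add: \<sigma>_def of_nat_diff)
  have "\<sigma> - (real n - 1) * (real n - 2) \<le> energy G \<phi> vs"
  \<comment> \<open>The estimate below multiplies by \<open>n - 2\<close>, which is negative for
    \<open>n = 1\<close>. In that case \<open>le\<close> gives \<sigma> \<le> 0, and the energy is
    nonnegative.\<close>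
  proof (cases "n = 1")
    case True
    then show ?thesis
      using E le order.trans[OF norm_ge_zero norm_le_sum_mset_norm, of "proots (char_poly (adjacency G \<phi> vs))"]
      by (simp flip: energy_def)
  next
    case False
    have "\<sigma> * (real n - 2) \<le> real n * (real n - 1) * (real n - 2)"
      using False n1 le by (intro mult_right_mono) auto
    \<comment> \<open>The previous inequality, with n \<sigma> split as \<sigma> (n - 2) + 2
      \<sigma>.\<close>
    then have "real n * (\<sigma> - (real n - 1) * (real n - 2)) \<le> 2 * \<sigma>"
      by (simp add: algebra_simps)
    also note E
    finally show ?thesis
      using n1 by simp
  qed
  with S show ?thesis
    by (simp add: algebra_simps power2_eq_square)
qed

end

lemma gain_graph_spanning_treeI:
  assumes "gain_graph G \<phi>" "undirected_spanning_tree T G" "r \<in> pverts G"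
  shows "gain_graph_spanning_tree G \<phi> T r"
proof -
  interpret gain_graph G \<phi> by fact
  interpret T: undirected_pair_tree T
    using assms(2) by (simp add: undirected_spanning_tree_def undirected_tree_iff)
  show ?thesis
    using assms(2,3) by unfold_locales (auto simp: undirected_spanning_tree_def spanning_def subgraph_def)
qed

section \<open>Sharpness\<close>

definition complete_graph :: "nat \<Rightarrow> nat pair_pre_digraph" where
  "complete_graph n = \<lparr>pverts = {0..<n}, parcs = {0..<n} \<times> {0..<n} - Id_on {0..<n}\<rparr>"

definition path_graph :: "nat \<Rightarrow> nat pair_pre_digraph" where
  "path_graph n = \<lparr>pverts = {0..<n}, parcs = {(u, v). u < n \<and> v < n \<and> (v = Suc u \<or> u = Suc v)}\<rparr>"

lemma complete_graph_simps [simp]: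
  "pverts (complete_graph n) = {0..<n}"
  "parcs (complete_graph n) = {0..<n} \<times> {0..<n} - Id_on {0..<n}"
  by (simp_all add: complete_graph_def)

lemma path_graph_simps [simp]:
  "pverts (path_graph n) = {0..<n}"
  "(u, v) \<in> parcs (path_graph n) \<longleftrightarrow> u < n \<and> v < n \<and> (v = Suc u \<or> u = Suc v)"
  by (simp_all add: path_graph_def)

lemma pair_graph_complete_graph: "pair_graph (complete_graph n)"
  by unfold_locales (auto simp: symmetric_def sym_def)

lemma parcs_path_graph_subset: "parcs (path_graph n) \<subseteq> parcs (complete_graph n)"
  by (auto simp: path_graph_def)

lemma pair_graph_path_graph: "pair_graph (path_graph n)"
proof
  show "finite (parcs (path_graph n))"
    using parcs_path_graph_subset[of n] by (rule finite_subset) simp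
qed (auto simp: path_graph_def symmetric_def sym_def)

lemma card_parcs_path_graph: "card (parcs (path_graph n)) \<le> 2 * (n - 1)"
proof -
  have "parcs (path_graph n) \<subseteq> (\<lambda>i. (i, Suc i)) ` {..<n - 1} \<union> (\<lambda>i. (Suc i, i)) ` {..<n - 1}"
    by (auto simp: path_graph_def)
  then have "card (parcs (path_graph n)) \<le> card ((\<lambda>i. (i, Suc i)) ` {..<n - 1} \<union> (\<lambda>i. (Suc i, i)) ` {..<n - 1})"
    by (intro card_mono) auto
  also have "\<dots> \<le> card ((\<lambda>i. (i, Suc i)) ` {..<n - 1}) + card ((\<lambda>i. (Suc i, i)) ` {..<n - 1})"
    by (rule card_Un_le)
  also have "\<dots> = 2 * (n - 1)"
    by (simp add: card_image inj_on_def)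
  finally show ?thesis .
qed

lemma (in pair_wf_digraph) awalk_crosses_cut:
  "awalk x p y \<Longrightarrow> x \<in> S \<Longrightarrow> y \<notin> S \<Longrightarrow> \<exists>(a, b)\<in>set p. a \<in> S \<and> b \<notin> S"
proof (induction p arbitrary: x)
  case (Cons e p)
  then show ?case
    by (cases "snd e \<in> S") (auto simp: awalk_Cons_iff split: prod.splits)
qed (auto simp: awalk_Nil_iff)

text \<open>An edge \<open>{a, a + 1}\<close> is the only one between \<open>{..a}\<close> and its complement, so a closed walk using
  it must return over it.\<close>

lemma path_graph_acyclic: "\<not> oriented_cycle (path_graph n) p"
proof
  interpret pair_graph "path_graph n"
    by (rule pair_graph_path_graph)
  assume cyc: "oriented_cycle (path_graph n) p"
  then have "p \<noteq> []"
    by (auto simp: oriented_cycle_def)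
  then obtain a b q where p: "p = (a, b) # q"
    by (cases p) auto
  have ab: "b = Suc a \<or> a = Suc b" and q: "apath b q a" "2 \<le> length q"
    using cyc by (auto simp: p oriented_cycle_Cons_iff)
  have arcs: "set q \<subseteq> parcs (path_graph n)"
    using q(1) by (auto simp: apath_def awalk_def)
  have "(b, a) \<in> set q"
    using ab
  proof
    assume [simp]: "b = Suc a"
    have "\<exists>(c, d)\<in>set q. c \<in> {a<..} \<and> d \<notin> {a<..}"
      using q(1) by (intro awalk_crosses_cut[OF awalkI_apath]) auto
    then obtain c d where "(c, d) \<in> set q" "a < c" "d \<le> a"
      by auto
    moreover from this have "c = b" "d = a"
      using arcs by auto
    ultimately show ?thesis by simp
  next
    assume [simp]: "a = Suc b"
    have "\<exists>(c, d)\<in>set q. c \<in> {..b} \<and> d \<notin> {..b}"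
      using q(1) by (intro awalk_crosses_cut[OF awalkI_apath]) auto
    then obtain c d where "(c, d) \<in> set q" "c \<le> b" "b < d"
      by auto
    moreover from this have "c = b" "d = a"
      using arcs by auto
    ultimately show ?thesis by simp
  qed
  then have "q = [(b, a)]"
    by (rule apath_ends_arc[OF q(1)])
  with q(2) show False
    by simp
qed

lemma path_graph_apath:
  assumes "u \<le> v" "v < n"
  shows "pre_digraph.apath (with_proj (path_graph n)) u (map (\<lambda>i. (i, Suc i)) [u..<v]) v"
    and "pawalk_verts u (map (\<lambda>i. (i, Suc i)) [u..<v]) = [u..<Suc v]"
proof -
  interpret pair_graph "path_graph n"
    by (rule pair_graph_path_graph)
  show verts: "pawalk_verts u (map (\<lambda>i. (i, Suc i)) [u..<v]) = [u..<Suc v]"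
    using assms(1) by (induction rule: inc_induct) (simp_all add: upt_conv_Cons del: upt_Suc)
  have "awalk u (map (\<lambda>i. (i, Suc i)) [u..<v]) v"
    using assms by (induction rule: inc_induct) (simp_all add: awalk_simps upt_conv_Cons)
  then show "apath u (map (\<lambda>i. (i, Suc i)) [u..<v]) v"
    by (simp add: apath_def verts del: upt_Suc)
qed

lemma undirected_tree_path_graph:
  assumes "n \<ge> 1"
  shows "undirected_tree (path_graph n)"
proof -
  interpret pair_graph "path_graph n"
    by (rule pair_graph_path_graph)
  have "u \<rightarrow>\<^sup>*\<^bsub>with_proj (path_graph n)\<^esub> v" if "u < n" "v < n" for u v
  proof (cases "u \<le> v")
    case True
    then show ?thesis
      using path_graph_apath(1)[OF _ that(2)] reachable_apath by blast
  next
    case False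
    then have "apath u (rev_path (map (\<lambda>i. (i, Suc i)) [v..<u])) v"
      using path_graph_apath(1)[OF _ that(1), of v] by simp
    then show ?thesis
      using reachable_apath by blast
  qed
  then have "Digraph_Component.connected (with_proj (path_graph n))"
    using assms by (intro connectedI) (auto intro: reachable_mk_symmetricI)
  then show ?thesis
    using pair_graph path_graph_acyclic by (auto simp: undirected_tree_def)
qed

text \<open>Rooted at its end 0, the path reaches \<open>v\<close> through exactly the vertices 0,
  ..., \<open>v\<close>. The tree order is thus the order of the numbers, which is total.\<close>

lemma normal_spanning_tree_path_graph:
  assumes "n \<ge> 1"
  shows "normal_spanning_tree (path_graph n) 0 (complete_graph n)"
proof -
  interpret P: pair_graph "path_graph n"
    by (rule pair_graph_path_graph)
  interpret K: pair_graph "complete_graph n"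
    by (rule pair_graph_complete_graph)
  have "spanning (with_proj (path_graph n)) (with_proj (complete_graph n))"
    using parcs_path_graph_subset[of n] P.wf_digraph K.wf_digraph
    by (auto simp: spanning_def subgraph_def compatible_def)
  moreover have "ancestor (path_graph n) 0 u v" if "u \<le> v" "v < n" for u v
    unfolding ancestor_def awalk_verts_with_proj_eq
    using path_graph_apath[OF le0 that(2)] that(1) by (metis atLeastLessThan_iff le0 le_imp_less_Suc set_upt)
  then have "\<forall>(u, v)\<in>parcs (complete_graph n). ancestor (path_graph n) 0 u v \<or> ancestor (path_graph n) 0 v u"
    by (auto simp: nat_le_linear) (meson nat_le_linear)
  ultimately show ?thesis
    using undirected_tree_path_graph[OF assms] assms
    by (simp add: normal_spanning_tree_def undirected_spanning_tree_def)
qed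

text \<open>The matrix is the all-ones matrix minus the identity. For an eigenvector with entry sum
  \<open>s\<close>, each row reads \<open>s = (e + 1) * v $ i\<close>; summing over the rows gives
  \<open>n * s = (e + 1) * s\<close>, and \<open>s\<close> can vanish only if
  \<open>e = -1\<close>.\<close>

lemma eigenvalue_complete_graph:
  assumes "eigenvalue (adjacency (complete_graph n) (\<lambda>_. 1) [0..<n]) e"
  shows "e = -1 \<or> e = of_nat n - 1"
proof -
  let ?A = "adjacency (complete_graph n) (\<lambda>_. 1) [0..<n]"
  have A: "?A \<in> carrier_mat n n"
    by (simp add: adjacency_def)
  obtain v where v: "v \<in> carrier_vec n" "v \<noteq> 0\<^sub>v n" "?A *\<^sub>v v = e \<cdot>\<^sub>v v"
    using assms A unfolding eigenvalue_def eigenvector_def by auto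
  define s where "s = (\<Sum>j = 0..<n. v $ j)"
  have s: "s = (e + 1) * v $ i" if "i < n" for i
  proof -
    have "e * v $ i = (?A *\<^sub>v v) $ i"
      using v that by simp
    also have "\<dots> = (\<Sum>j = 0..<n. (if i = j then 0 else v $ j))"
      using A v(1) that by (auto simp: scalar_prod_def adjacency_def Id_on_def intro!: sum.cong)
    also have "\<dots> = (\<Sum>j = 0..<n. v $ j - (if i = j then v $ j else 0))"
      by (intro sum.cong) auto
    also have "\<dots> = s - v $ i"
      using that by (simp add: s_def sum_subtractf)
    finally show ?thesis
      by (simp add: algebra_simps)
  qed
  show ?thesis
  proof (cases "e = -1")
    case False
    then have e1: "e + 1 \<noteq> 0"
      by (simp add: add_eq_0_iff2)
    have "s \<noteq> 0"
    proof
      assume "s = 0"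
      then have "v = 0\<^sub>v n"
        using s e1 v(1) by (intro eq_vecI) auto
      with v(2) show False ..
    qed
    moreover have "(e + 1) * s = of_nat n * s"
    proof -
      have "(e + 1) * s = (\<Sum>j = 0..<n. (e + 1) * v $ j)"
        by (simp add: s_def sum_distrib_left)
      also have "\<dots> = (\<Sum>j = 0..<n. s)"
        using s by (intro sum.cong) auto
      finally show ?thesis
        by simp
    qed
    ultimately have "e + 1 = of_nat n"
      by simp
    then show ?thesis
      by (metis add_diff_cancel_right')
  qed simp
qed

text \<open>On both possible eigenvalues \<open>-1\<close> and \<open>n - 1\<close>, the modulus is the affine function
  \<open>z \<mapsto> ((n - 2) z + 2 (n - 1)) / n\<close>, so trace and size determine the energy.\<close>

lemma energy_complete_graph:
  assumes "n \<ge> 1"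
  shows "energy (complete_graph n) (\<lambda>_. 1) [0..<n] = 2 * (real n - 1)"
proof -
  let ?A = "adjacency (complete_graph n) (\<lambda>_. 1) [0..<n]"
  let ?M = "proots (char_poly ?A)"
  have A: "?A \<in> carrier_mat n n"
    by (simp add: adjacency_def)
  define c d where "c = (real n - 2) / n" and "d = 2 * (real n - 1) / n"
  have norm: "cmod z = c * Re z + d" if "z \<in># ?M" for z
  proof -
    have "z = complex_of_real (-1) \<or> z = complex_of_real (real n - 1)"
      using that eigenvalue_complete_graph proots_char_poly(3)[OF A] by simp
    then show ?thesis
      using assms by (elim disjE) (simp_all only: norm_of_real Re_complex_of_real, simp_all add: c_def d_def field_simps)
  qed
  have affine: "(\<Sum>z\<in>#M. c * Re z + d) = c * Re (\<Sum>z\<in>#M. z) + size M * d" for M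
    by (induction M) (simp_all add: algebra_simps)
  have "energy (complete_graph n) (\<lambda>_. 1) [0..<n] = (\<Sum>z\<in>#?M. c * Re z + d)"
    unfolding energy_def using norm by (intro arg_cong[where f = sum_mset] image_mset_cong)
  also have "\<dots> = n * d"
  proof -
    have "(\<Sum>i = 0..<n. ?A $$ (i, i)) = 0"
      by (intro sum.neutral) (auto simp: adjacency_def Id_on_def)
    then show ?thesis
      unfolding affine proots_char_poly[OF A] by simp
  qed
  also have "\<dots> = 2 * (real n - 1)"
    using assms by (simp add: d_def)
  finally show ?thesis .
qed

text \<open>With trivial gains every gauged arc has value 1, so the arc counts alone determine the
  cycle sum. The path has at most 2 (n - 1) arcs, which makes the right-hand side at least 2 (n -
  1), the energy; the general bound gives the other inequality.\<close>

lemma complete_graph_sharp: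
  assumes "n \<ge> 1"
  shows "gain_graph (complete_graph n) (\<lambda>_. 1)"
    and "Digraph_Component.connected (with_proj (complete_graph n))"
    and "energy (complete_graph n) (\<lambda>_. 1) [0..<n] =
      2 * (\<Sum>C\<in>fundamental_cycles (complete_graph n) (path_graph n). re_gain (complete_graph n) (\<lambda>_. 1) C) +
        (5 * real n - (real n)\<^sup>2 - 4)"
proof -
  show gain: "gain_graph (complete_graph n) (\<lambda>_. 1)"
    by (simp add: gain_graph_def gain_graph_axioms_def pair_graph_complete_graph)
  interpret K: pair_graph "complete_graph n"
    by (rule pair_graph_complete_graph)
  have tree: "undirected_spanning_tree (path_graph n) (complete_graph n)"
    using normal_spanning_tree_path_graph[OF assms] by (simp add: normal_spanning_tree_def)
  then show "Digraph_Component.connected (with_proj (complete_graph n))"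
    using K.connected_spanning_imp_connected
    by (auto simp: undirected_spanning_tree_def undirected_tree_def)
  interpret gain_graph_spanning_tree "complete_graph n" "\<lambda>_. 1" "path_graph n" 0
    using gain tree assms by (intro gain_graph_spanning_treeI) auto
  have "potential v = 1" for v
  proof -
    have "walk_gain (\<lambda>_. 1) p = 1" for p :: "(nat \<times> nat) list"
      by (induction p) auto
    then show ?thesis
      by (simp add: potential_def)
  qed
  then have "real (card (parcs (complete_graph n))) = real (card (parcs (path_graph n))) +
      2 * (\<Sum>C\<in>fundamental_cycles (complete_graph n) (path_graph n). re_gain (complete_graph n) (\<lambda>_. 1) C)"
    using sum_gauged_gains by (simp add: case_prod_unfold)
  moreover have "real (card (parcs (complete_graph n))) = real n * (real n - 1)"
    using card_off_diagonal[of "{0..<n}"] assms by (simp add: of_nat_diff)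
  moreover have "real (card (parcs (path_graph n))) \<le> 2 * (real n - 1)"
    using of_nat_mono[OF card_parcs_path_graph[of n], where 'a = real] assms by (simp add: of_nat_diff)
  moreover have "2 * (\<Sum>C\<in>fundamental_cycles (complete_graph n) (path_graph n). re_gain (complete_graph n) (\<lambda>_. 1) C) +
        (5 * real n - (real n)\<^sup>2 - 4) \<le> energy (complete_graph n) (\<lambda>_. 1) [0..<n]"
    by (rule energy_lower_bound) auto
  ultimately show "energy (complete_graph n) (\<lambda>_. 1) [0..<n] =
      2 * (\<Sum>C\<in>fundamental_cycles (complete_graph n) (path_graph n). re_gain (complete_graph n) (\<lambda>_. 1) C) +
        (5 * real n - (real n)\<^sup>2 - 4)"
    unfolding energy_complete_graph[OF assms] by (simp add: algebra_simps power2_eq_square)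
qed

text \<open>Sharpness is taken in the strong sense that equality occurs for every number of vertices
  \<open>n \<ge> 1\<close>; a root exists only on a nonempty vertex set. The witnesses live on
  \<open>nat\<close> because the type \<open>'a\<close> may have fewer than \<open>n\<close>
  elements.\<close>

theorem theorem4p1:
  shows "(\<forall>(G :: 'a pair_pre_digraph) \<phi> vs T r n.
      gain_graph G \<phi> \<and> distinct vs \<and> set vs = pverts G \<and> n = card (pverts G) \<and>
      Digraph_Component.connected (with_proj G) \<and> normal_spanning_tree T r G \<longrightarrow>
      energy G \<phi> vs \<ge>
        2 * (\<Sum>C\<in>fundamental_cycles G T. re_gain G \<phi> C) + (5 * real n - (real n)\<^sup>2 - 4))
    \<and>
    (\<forall>n\<ge>1. \<exists>(G :: nat pair_pre_digraph) \<phi> vs T r.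
      gain_graph G \<phi> \<and> distinct vs \<and> set vs = pverts G \<and> n = card (pverts G) \<and>
      Digraph_Component.connected (with_proj G) \<and> normal_spanning_tree T r G \<and>
      energy G \<phi> vs =
        2 * (\<Sum>C\<in>fundamental_cycles G T. re_gain G \<phi> C) + (5 * real n - (real n)\<^sup>2 - 4))"
proof (intro conjI allI impI; (elim conjE)?)
  fix G :: "'a pair_pre_digraph" and \<phi> vs T r n
  assume G: "gain_graph G \<phi>" and vs: "distinct vs" "set vs = pverts G" and n: "n = card (pverts G)"
    and T: "normal_spanning_tree T r G"
  have "undirected_spanning_tree T G" "r \<in> pverts G"
    using T by (auto simp: normal_spanning_tree_def undirected_spanning_tree_def spanning_def)
  then interpret gain_graph_spanning_tree G \<phi> T r
    by (rule gain_graph_spanning_treeI[OF G])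
  show "2 * (\<Sum>C\<in>fundamental_cycles G T. re_gain G \<phi> C) + (5 * real n - (real n)\<^sup>2 - 4) \<le> energy G \<phi> vs"
    using vs n by (rule energy_lower_bound)
next
  fix n :: nat
  assume n: "n \<ge> 1"
  show "\<exists>(G :: nat pair_pre_digraph) \<phi> vs T r.
      gain_graph G \<phi> \<and> distinct vs \<and> set vs = pverts G \<and> n = card (pverts G) \<and>
      Digraph_Component.connected (with_proj G) \<and> normal_spanning_tree T r G \<and>
      energy G \<phi> vs =
        2 * (\<Sum>C\<in>fundamental_cycles G T. re_gain G \<phi> C) + (5 * real n - (real n)\<^sup>2 - 4)"
    using complete_graph_sharp[OF n] normal_spanning_tree_path_graph[OF n]
    by (intro exI[of _ "complete_graph n"] exI[of _ "\<lambda>_. 1"] exI[of _ "[0..<n]"]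
        exI[of _ "path_graph n"] exI[of _ 0]) simp
qed

end
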